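(* Let $M=M_0+\sum_{|\alpha|\le d}c_\alpha M_\alpha$ be a uniform determinantal representation of size $N$ of the generic polynomial $p_{n,d}=\sum_{|\alpha|\le d}c_\alpha x^\alpha$ of degree $d$ in $n$ variables, where the entries of $M_0$ and of all $M_\alpha$ are polynomials of degree at most $1$ in $K[x_1,\ldots,x_n]$. Assume that there exist matrices $Q$ and $Z$, whose elements are polynomials in $x_1,\ldots,x_n$, such that $\det(Q)=\det(Z)=1$ and $QMZ$ is a triangular matrix with one diagonal element equal to $p_{n,d}$ and all other diagonal elements equal to $1$. Let $C_\alpha$ ($|\alpha|\le d$) be $k\times k$ matrices over $K$ and let $P_{n,d}=\sum_{|\alpha|\le d}x^\alpha C_\alpha$ be the corresponding matrix polynomial. Then $$\widetilde M=M_0\otimes I_k+\sum_{|\alpha|\le d}M_\alpha\otimes C_\alpha$$ is a representation for the matrix polynomial $P_{n,d}$, i.e. $\det(\widetilde M)=\det(P_{n,d})$.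
   Context: Let $K$ be a field, $x=(x_1,\ldots,x_n)$, $\alpha\in\mathbb{Z}_{\ge 0}^n$, $|\alpha|=\sum_i\alpha_i$, $x^\alpha=\prod_i x_i^{\alpha_i}$, and regard each $c_\alpha$ as a variable. A uniform determinantal representation of $p_{n,d}$ of size $N$ is an $N\times N$ matrix $M$ whose entries are $K$-linear combinations of the monomials $1,x_i,c_\alpha,c_\alpha x_i$ ($1\le i\le n$, $|\alpha|\le d$), such that $\det(M)=p_{n,d}$. $I_k$ is the $k\times k$ identity matrix and $\otimes$ is the Kronecker product. *)

theory Defs
  imports Jordan_Normal_Form.Determinant "HOL-Library.Poly_Mapping"
begin

(* The polynomial ring K[x, c]: a monomial is a finitely supported exponent function on
   the variables, and multiplication of poly_mappings is the convolution product.
   A multi-index is a finitely supported function on {1..n}. Cvar provides a variable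
   for every multi-index; only those in multi_indices n d occur below. *)

type_synonym multi_index = "nat \<Rightarrow>\<^sub>0 nat"

datatype pvar = Xvar nat | Cvar multi_index

type_synonym 'a pring = "(pvar \<Rightarrow>\<^sub>0 nat) \<Rightarrow>\<^sub>0 'a"

definition const :: "'a::field \<Rightarrow> 'a pring" where
  "const a = Poly_Mapping.single 0 a"

definition x_var :: "nat \<Rightarrow> 'a::field pring" where
  "x_var i = Poly_Mapping.single (Poly_Mapping.single (Xvar i) 1) 1"

definition c_var :: "multi_index \<Rightarrow> 'a::field pring" where
  "c_var \<alpha> = Poly_Mapping.single (Poly_Mapping.single (Cvar \<alpha>) 1) 1"

definition mdeg :: "('v \<Rightarrow>\<^sub>0 nat) \<Rightarrow> nat" where
  "mdeg m = (\<Sum>v\<in>Poly_Mapping.keys m. Poly_Mapping.lookup m v)"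

definition multi_indices :: "nat \<Rightarrow> nat \<Rightarrow> multi_index set" where
  "multi_indices n d = {\<alpha>. Poly_Mapping.keys \<alpha> \<subseteq> {1..n} \<and> mdeg \<alpha> \<le> d}"

lemma finite_multi_indices: "finite (multi_indices n d)"
proof -
  let ?F = "{f :: nat \<Rightarrow> nat. \<forall>i. (i \<in> {1..n} \<longrightarrow> f i \<in> {..d}) \<and> (i \<notin> {1..n} \<longrightarrow> f i = 0)}"
  have "Poly_Mapping.lookup ` multi_indices n d \<subseteq> ?F"
  proof (clarify)
    fix \<alpha> :: multi_index and i
    assume "\<alpha> \<in> multi_indices n d"
    then have k: "Poly_Mapping.keys \<alpha> \<subseteq> {1..n}" and s: "mdeg \<alpha> \<le> d"
      by (auto simp: multi_indices_def)
    have "Poly_Mapping.lookup \<alpha> i \<le> mdeg \<alpha>"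
      by (cases "i \<in> Poly_Mapping.keys \<alpha>") (auto simp: mdeg_def in_keys_iff intro: member_le_sum)
    with k s show "(i \<in> {1..n} \<longrightarrow> Poly_Mapping.lookup \<alpha> i \<in> {..d}) \<and> (i \<notin> {1..n} \<longrightarrow> Poly_Mapping.lookup \<alpha> i = 0)"
      by (auto simp: in_keys_iff subset_iff)
  qed
  moreover have "finite ?F"
    by (rule finite_set_of_finite_funs) auto
  ultimately have "finite (Poly_Mapping.lookup ` multi_indices n d)"
    by (rule finite_subset)
  then show ?thesis
    by (rule finite_imageD) (auto intro: inj_onI poly_mapping_eqI)
qed

definition xpow :: "nat \<Rightarrow> multi_index \<Rightarrow> 'a::field pring" where
  "xpow n \<alpha> = (\<Prod>i=1..n. x_var i ^ Poly_Mapping.lookup \<alpha> i)"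

definition generic_poly :: "nat \<Rightarrow> nat \<Rightarrow> 'a::field pring" where
  "generic_poly n d = (\<Sum>\<alpha>\<in>multi_indices n d. c_var \<alpha> * xpow n \<alpha>)"

(* K[x_1, ..., x_n] as a subset of K[x, c] *)
definition polys_in_x :: "nat \<Rightarrow> 'a::field pring set" where
  "polys_in_x n = {p. \<forall>m\<in>Poly_Mapping.keys p. Poly_Mapping.keys m \<subseteq> Xvar ` {1..n}}"

(* total degree, with value 0 for the zero polynomial *)
definition tdeg :: "'a::field pring \<Rightarrow> nat" where
  "tdeg p = Max (insert 0 (mdeg ` Poly_Mapping.keys p))"

(* the K-span of S; meaningful for finite S only *)
definition lin_combs :: "'a::field pring set \<Rightarrow> 'a pring set" where
  "lin_combs S = {\<Sum>m\<in>S. const (f m) * m | f. True}"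

definition rep_monomials :: "nat \<Rightarrow> nat \<Rightarrow> 'a::field pring set" where
  "rep_monomials n d =
     {1} \<union> x_var ` {1..n} \<union> c_var ` multi_indices n d
     \<union> {c_var \<alpha> * x_var i | \<alpha> i. \<alpha> \<in> multi_indices n d \<and> i \<in> {1..n}}"

lemma finite_rep_monomials: "finite (rep_monomials n d)"
  unfolding rep_monomials_def
  by (simp add: finite_multi_indices finite_image_set2)

definition entries_in :: "'b mat \<Rightarrow> 'b set \<Rightarrow> bool" where
  "entries_in A S \<longleftrightarrow> (\<forall>i<dim_row A. \<forall>j<dim_col A. A $$ (i, j) \<in> S)"

definition uniform_det_rep :: "nat \<Rightarrow> nat \<Rightarrow> nat \<Rightarrow> 'a::field pring mat \<Rightarrow> bool" where
  "uniform_det_rep n d N M \<longleftrightarrow>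
     M \<in> carrier_mat N N
     \<and> entries_in M (lin_combs (rep_monomials n d))
     \<and> det M = generic_poly n d"

definition triangular :: "'b::zero mat \<Rightarrow> bool" where
  "triangular A \<longleftrightarrow> upper_triangular A \<or> upper_triangular (transpose_mat A)"

(* Entrywise sum of square matrices of size s: the size has to be passed explicitly, as the
   type of matrices has no zero element. *)
definition mat_sum :: "nat \<Rightarrow> ('i \<Rightarrow> 'b::comm_monoid_add mat) \<Rightarrow> 'i set \<Rightarrow> 'b mat" where
  "mat_sum s F I = mat s s (\<lambda>ij. \<Sum>\<alpha>\<in>I. F \<alpha> $$ ij)"

definition kronecker :: "'b::times mat \<Rightarrow> 'b mat \<Rightarrow> 'b mat" (infixl \<open>\<otimes>\<^sub>K\<close> 72) where
  "A \<otimes>\<^sub>K B = mat (dim_row A * dim_row B) (dim_col A * dim_col B)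
     (\<lambda>(i, j). A $$ (i div dim_row B, j div dim_col B) * B $$ (i mod dim_row B, j mod dim_col B))"

definition matrix_poly ::
  "nat \<Rightarrow> nat \<Rightarrow> nat \<Rightarrow> (multi_index \<Rightarrow> 'a::field mat) \<Rightarrow> 'a pring mat" where
  "matrix_poly n d k C = mat_sum k (\<lambda>\<alpha>. xpow n \<alpha> \<cdot>\<^sub>m map_mat const (C \<alpha>)) (multi_indices n d)"

end

theory Submission
  imports Defs
begin

text \<open>
  The matrices \<open>Q\<close> and \<open>Z\<close> do not involve the variables \<open>c\<^sub>\<alpha>\<close>, so
  \<open>Q * M * Z = T\<^sub>0 + (\<Sum>\<alpha>. c\<^sub>\<alpha> T\<^sub>\<alpha>)\<close> with \<open>T\<^sub>0 = Q * M\<^sub>0 * Z\<close> and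
  \<open>T\<^sub>\<alpha> = Q * M\<^sub>\<alpha> * Z\<close> over \<open>K[x]\<close>. Since \<open>1\<close> and the \<open>c\<^sub>\<alpha>\<close> are linearly independent
  over \<open>K[x]\<close> (\<open>c_var_independent\<close>), the known entries of the triangular matrix \<open>Q * M * Z\<close>
  determine those of \<open>T\<^sub>0\<close> and of every \<open>T\<^sub>\<alpha>\<close>: all of them vanish on the same side of the
  diagonal, \<open>T\<^sub>0\<close> has diagonal entries \<open>1\<close> except for a \<open>0\<close> at the position \<open>r\<close> of the
  generic polynomial, and the only nonzero diagonal entry of \<open>T\<^sub>\<alpha>\<close> is \<open>x\<^sup>\<alpha>\<close> at the position
  \<open>r\<close>.

  By the mixed product rule (\<open>kronecker_mult\<close>), multiplying the matrix of the theorem by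
  \<open>Q \<otimes> I\<^sub>k\<close> from the left and by \<open>Z \<otimes> I\<^sub>k\<close> from the right turns it into
  \<open>T\<^sub>0 \<otimes> I\<^sub>k + (\<Sum>\<alpha>. T\<^sub>\<alpha> \<otimes> C\<^sub>\<alpha>)\<close>. This matrix is block triangular with diagonal blocks \<open>I\<^sub>k\<close>
  and, at position \<open>r\<close>, \<open>\<Sum>\<alpha>. x\<^sup>\<alpha> C\<^sub>\<alpha>\<close>; its determinant is therefore that of the matrix
  polynomial (\<open>det_block_upper_triangular\<close>, \<open>det_block_lower_triangular\<close>). The two factors
  have determinants \<open>det Q ^ k = 1\<close> and \<open>det Z ^ k = 1\<close> (\<open>det_kronecker_one\<close>), so the
  multiplication does not change the determinant.
\<close>

section \<open>Determinants of block triangular matrices\<close>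

lemma det_unit_first_rows:
  fixes A :: "'a::comm_ring_1 mat"
  assumes "A \<in> carrier_mat (n + m) (n + m)"
    and "\<And>i j. i < n \<Longrightarrow> j < n + m \<Longrightarrow> A $$ (i, j) = (if i = j then 1 else 0)"
  shows "det A = det (mat m m (\<lambda>(i, j). A $$ (n + i, n + j)))"
  using assms
proof (induction n arbitrary: A)
  case 0
  then have "mat m m (\<lambda>(i, j). A $$ (0 + i, 0 + j)) = A"
    by (intro eq_matI) auto
  then show ?case by simp
next
  case (Suc n)
  let ?B = "mat_delete A 0 0"
  have A: "A \<in> carrier_mat (Suc (n + m)) (Suc (n + m))" using Suc.prems(1) by simp
  have B: "?B \<in> carrier_mat (n + m) (n + m)" using mat_delete_carrier[OF A] by simp
  have Bij: "?B $$ (i, j) = A $$ (Suc i, Suc j)" if "i < n + m" "j < n + m" for i j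
    using that A by (simp add: mat_delete_def)
  have "det A = (\<Sum>j<Suc (n + m). A $$ (0, j) * cofactor A 0 j)"
    using laplace_expansion_row[OF A, of 0] by simp
  also have "\<dots> = (\<Sum>j<Suc (n + m). if j = 0 then cofactor A 0 0 else 0)"
    using Suc.prems(2)[of 0] by (intro sum.cong) auto
  also have "\<dots> = det ?B" by (simp add: cofactor_def)
  also have "\<dots> = det (mat m m (\<lambda>(i, j). ?B $$ (n + i, n + j)))"
    by (rule Suc.IH[OF B]) (use Suc.prems(2) Bij in auto)
  also have "mat m m (\<lambda>(i, j). ?B $$ (n + i, n + j)) = mat m m (\<lambda>(i, j). A $$ (Suc n + i, Suc n + j))"
    by (intro eq_matI) (auto simp: Bij)
  finally show ?case .
qed

lemma det_unit_last_rows: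
  fixes A :: "'a::comm_ring_1 mat"
  assumes "A \<in> carrier_mat (n + m) (n + m)"
    and "\<And>i j. i < m \<Longrightarrow> j < n + m \<Longrightarrow> A $$ (n + i, j) = (if n + i = j then 1 else 0)"
  shows "det A = det (mat n n (\<lambda>(i, j). A $$ (i, j)))"
  using assms
proof (induction m arbitrary: A)
  case 0
  then have "mat n n (\<lambda>(i, j). A $$ (i, j)) = A"
    by (intro eq_matI) auto
  then show ?case by simp
next
  case (Suc m)
  let ?B = "mat_delete A (n + m) (n + m)"
  have A: "A \<in> carrier_mat (Suc (n + m)) (Suc (n + m))" using Suc.prems(1) by simp
  have B: "?B \<in> carrier_mat (n + m) (n + m)" using mat_delete_carrier[OF A] by simp
  have Bij: "?B $$ (i, j) = A $$ (i, j)" if "i < n + m" "j < n + m" for i j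
    using that A by (simp add: mat_delete_def)
  have "det A = (\<Sum>j<Suc (n + m). A $$ (n + m, j) * cofactor A (n + m) j)"
    using laplace_expansion_row[OF A, of "n + m"] by simp
  also have "\<dots> = (\<Sum>j<Suc (n + m). if j = n + m then cofactor A (n + m) (n + m) else 0)"
    using Suc.prems(2)[of m] by (intro sum.cong) auto
  also have "\<dots> = det ?B" by (simp add: cofactor_def)
  also have "\<dots> = det (mat n n (\<lambda>(i, j). ?B $$ (i, j)))"
    by (rule Suc.IH[OF B]) (use Suc.prems(2) Bij in auto)
  also have "mat n n (\<lambda>(i, j). ?B $$ (i, j)) = mat n n (\<lambda>(i, j). A $$ (i, j))"
    by (intro eq_matI) (auto simp: Bij)
  finally show ?case .
qed

text \<open>
  The factorization of \<open>[A, B; 0, D]\<close> as \<open>[1, 0; 0, D]\<close> times \<open>[A, B; 0, 1]\<close> reduces the claim to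
  the two preceding lemmas. The argument needs no cancellation, so it is valid over rings with
  zero divisors.
\<close>

lemma det_four_block_lower_left_zero_comm_ring:
  fixes A B D :: "'a::comm_ring_1 mat"
  assumes A: "A \<in> carrier_mat n n" and B: "B \<in> carrier_mat n m" and D: "D \<in> carrier_mat m m"
  shows "det (four_block_mat A B (0\<^sub>m m n) D) = det A * det D"
proof -
  let ?L = "four_block_mat (1\<^sub>m n) (0\<^sub>m n m) (0\<^sub>m m n) D"
  let ?R = "four_block_mat A B (0\<^sub>m m n) (1\<^sub>m m)"
  have L: "?L \<in> carrier_mat (n + m) (n + m)" and R: "?R \<in> carrier_mat (n + m) (n + m)"
    using A D by auto
  have "four_block_mat A B (0\<^sub>m m n) D = ?L * ?R"
    by (subst mult_four_block_mat[of _ n n _ m _ m _ _ n _ m]) (use A B D in auto)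
  then have "det (four_block_mat A B (0\<^sub>m m n) D) = det ?L * det ?R"
    using det_mult[OF L R] by simp
  also have "det ?L = det (mat m m (\<lambda>(i, j). ?L $$ (n + i, n + j)))"
    by (rule det_unit_first_rows[OF L]) (use D in auto)
  also have "mat m m (\<lambda>(i, j). ?L $$ (n + i, n + j)) = D"
    by (intro eq_matI) (use D in auto)
  also have "det ?R = det (mat n n (\<lambda>(i, j). ?R $$ (i, j)))"
    by (rule det_unit_last_rows[OF R]) (use A in auto)
  also have "mat n n (\<lambda>(i, j). ?R $$ (i, j)) = A"
    by (intro eq_matI) (use A in auto)
  finally show ?thesis by (simp add: mult.commute)
qed

text \<open>
  A matrix of size \<open>N * k\<close> is regarded as an \<open>N\<close> by \<open>N\<close> matrix of blocks of size \<open>k\<close>: the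
  index \<open>u * k + a\<close> with \<open>a < k\<close> is the \<open>a\<close>-th index of the block \<open>u\<close>. The quotient and the
  remainder of an index by \<open>k\<close> recover \<open>u\<close> and \<open>a\<close>.
\<close>

lemma block_index_less: "u < N \<Longrightarrow> a < k \<Longrightarrow> u * k + a < N * (k::nat)"
proof -
  assume "u < N" "a < k"
  moreover from this have "Suc u * k \<le> N * k" by (intro mult_le_mono1) simp
  ultimately show ?thesis by simp
qed

lemma det_block_upper_triangular:
  fixes A :: "'a::comm_ring_1 mat"
  assumes "A \<in> carrier_mat (N * k) (N * k)"
    and "\<And>i j. i < N * k \<Longrightarrow> j < N * k \<Longrightarrow> j div k < i div k \<Longrightarrow> A $$ (i, j) = 0"
  shows "det A = (\<Prod>u<N. det (mat k k (\<lambda>(a, b). A $$ (u * k + a, u * k + b))))"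
  using assms
proof (induction N arbitrary: A)
  case 0
  then show ?case by simp
next
  case (Suc N)
  let ?n = "N * k"
  let ?A1 = "mat ?n ?n (\<lambda>(i, j). A $$ (i, j))"
  let ?A2 = "mat ?n k (\<lambda>(i, j). A $$ (i, ?n + j))"
  let ?A4 = "mat k k (\<lambda>(i, j). A $$ (?n + i, ?n + j))"
  have zero: "A $$ (i, j) = 0" if "?n \<le> i" "i < ?n + k" "j < ?n" for i j
  proof -
    have k: "0 < k" using that by (cases k) auto
    have "j div k < N" using that(3) by (simp add: less_mult_imp_div_less)
    also have "N \<le> i div k" using that(1) k by (simp add: less_eq_div_iff_mult_less_eq)
    finally show ?thesis using that by (intro Suc.prems(2)) auto
  qed
  have "A = four_block_mat ?A1 ?A2 (0\<^sub>m k ?n) ?A4"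
    by (intro eq_matI) (use Suc.prems(1) zero in \<open>auto simp: not_less\<close>)
  then have "det A = det ?A1 * det ?A4"
    using det_four_block_lower_left_zero_comm_ring[of ?A1 ?n ?A2 k ?A4] by simp
  also have "det ?A1 = (\<Prod>u<N. det (mat k k (\<lambda>(a, b). ?A1 $$ (u * k + a, u * k + b))))"
    by (rule Suc.IH) (use Suc.prems in auto)
  also have "\<dots> = (\<Prod>u<N. det (mat k k (\<lambda>(a, b). A $$ (u * k + a, u * k + b))))"
  proof (rule prod.cong[OF refl])
    fix u assume "u \<in> {..<N}"
    then have "mat k k (\<lambda>(a, b). ?A1 $$ (u * k + a, u * k + b))
        = mat k k (\<lambda>(a, b). A $$ (u * k + a, u * k + b))"
      by (intro eq_matI) (auto simp: block_index_less)
    then show "det (mat k k (\<lambda>(a, b). ?A1 $$ (u * k + a, u * k + b)))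
        = det (mat k k (\<lambda>(a, b). A $$ (u * k + a, u * k + b)))" by simp
  qed
  finally show ?case by simp
qed

lemma det_block_lower_triangular:
  fixes A :: "'a::comm_ring_1 mat"
  assumes A: "A \<in> carrier_mat (N * k) (N * k)"
    and zero: "\<And>i j. i < N * k \<Longrightarrow> j < N * k \<Longrightarrow> i div k < j div k \<Longrightarrow> A $$ (i, j) = 0"
  shows "det A = (\<Prod>u<N. det (mat k k (\<lambda>(a, b). A $$ (u * k + a, u * k + b))))"
proof -
  have "det A = det (transpose_mat A)" using det_transpose[OF A] by simp
  also have "\<dots> = (\<Prod>u<N. det (mat k k (\<lambda>(a, b). transpose_mat A $$ (u * k + a, u * k + b))))"
    by (rule det_block_upper_triangular) (use A zero in auto)
  also have "\<dots> = (\<Prod>u<N. det (mat k k (\<lambda>(a, b). A $$ (u * k + a, u * k + b))))"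
  proof (intro prod.cong refl)
    fix u assume "u \<in> {..<N}"
    then have lt: "u * k + a < N * k" if "a < k" for a using that by (simp add: block_index_less)
    have "mat k k (\<lambda>(a, b). transpose_mat A $$ (u * k + a, u * k + b))
        = transpose_mat (mat k k (\<lambda>(a, b). A $$ (u * k + a, u * k + b)))"
      by (intro eq_matI) (use A lt in auto)
    then show "det (mat k k (\<lambda>(a, b). transpose_mat A $$ (u * k + a, u * k + b)))
        = det (mat k k (\<lambda>(a, b). A $$ (u * k + a, u * k + b)))"
      by (simp add: det_transpose[of _ k])
  qed
  finally show ?thesis .
qed

section \<open>Kronecker products\<close>

lemma det_permute_rows_cols:
  fixes A :: "'a::comm_ring_1 mat"
  assumes A: "A \<in> carrier_mat n n" and p: "p permutes {0..<n}"
  shows "det (mat n n (\<lambda>(i, j). A $$ (p i, p j))) = det A"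
proof -
  let ?B = "mat n n (\<lambda>(i, j). A $$ (p i, j))"
  have lt: "p i < n" if "i < n" for i
    using permutes_in_image[OF p, of i] that by simp
  have "mat n n (\<lambda>(i, j). A $$ (p i, p j)) = transpose_mat (mat n n (\<lambda>(i, j). transpose_mat ?B $$ (p i, j)))"
    by (intro eq_matI) (use lt in auto)
  then have "det (mat n n (\<lambda>(i, j). A $$ (p i, p j))) = det (mat n n (\<lambda>(i, j). transpose_mat ?B $$ (p i, j)))"
    by (simp add: det_transpose[of _ n])
  also have "\<dots> = signof p * det (transpose_mat ?B)"
    by (rule det_permute_rows[OF _ p]) simp
  also have "det (transpose_mat ?B) = signof p * det A"
    using det_permute_rows[OF A p] by (simp add: det_transpose[of _ n])
  also have "signof p * (signof p * det A) = det A"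
    by (simp add: sign_def)
  finally show ?thesis .
qed

lemma index_kronecker:
  assumes "i < dim_row A * dim_row B" "j < dim_col A * dim_col B"
  shows "(A \<otimes>\<^sub>K B) $$ (i, j) =
    A $$ (i div dim_row B, j div dim_col B) * B $$ (i mod dim_row B, j mod dim_col B)"
  using assms by (simp add: kronecker_def)

lemma kronecker_carrier_mat [simp]:
  "A \<in> carrier_mat n m \<Longrightarrow> B \<in> carrier_mat k l \<Longrightarrow> A \<otimes>\<^sub>K B \<in> carrier_mat (n * k) (m * l)"
  by (auto simp: kronecker_def)

lemma mod_less_factor: "i < N * k \<Longrightarrow> i mod k < (k::nat)"
  by (cases k) auto

text \<open>
  Simultaneous permutation of rows and columns turns \<open>Q \<otimes> I\<^sub>k\<close> into \<open>I\<^sub>k \<otimes> Q\<close>, which is block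
  diagonal with \<open>k\<close> blocks \<open>Q\<close>.
\<close>

lemma det_kronecker_one:
  fixes Q :: "'a::comm_ring_1 mat"
  assumes Q: "Q \<in> carrier_mat N N"
  shows "det (Q \<otimes>\<^sub>K 1\<^sub>m k) = det Q ^ k"
proof -
  let ?K = "Q \<otimes>\<^sub>K 1\<^sub>m k"
  \<comment> \<open>the index of \<open>I\<^sub>k \<otimes> Q\<close> with quotient \<open>a\<close> and remainder \<open>u\<close> modulo \<open>N\<close> goes to \<open>u * k + a\<close>\<close>
  define p where "p i = (if i < k * N then (i mod N) * k + i div N else i)" for i
  have K: "?K \<in> carrier_mat (k * N) (k * N)"
    using kronecker_carrier_mat[OF Q one_carrier_mat[of k]] by (simp add: mult.commute)
  have lt: "i div N < k" "i mod N < N" "p i < k * N" if "i < k * N" for i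
  proof -
    show 1: "i div N < k" using that by (simp add: less_mult_imp_div_less)
    show 2: "i mod N < N" using that by (rule mod_less_factor)
    show "p i < k * N" using block_index_less[OF 2 1] that by (simp add: p_def mult.commute)
  qed
  have dm: "p i div k = i mod N" "p i mod k = i div N" if "i < k * N" for i
    using lt[OF that] that by (auto simp: p_def)
  have "inj_on p {0..<k * N}"
  proof (rule inj_onI)
    fix i j assume ij: "i \<in> {0..<k * N}" "j \<in> {0..<k * N}" "p i = p j"
    then have "i mod N = j mod N" "i div N = j div N" using dm[of i] dm[of j] by auto
    then show "i = j" by (metis div_mod_decomp)
  qed
  moreover have "p ` {0..<k * N} \<subseteq> {0..<k * N}" using lt by auto
  ultimately have "bij_betw p {0..<k * N} {0..<k * N}"
    by (simp add: bij_betw_def endo_inj_surj)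
  then have p: "p permutes {0..<k * N}"
    by (rule bij_imp_permutes) (auto simp: p_def)
  let ?P = "mat (k * N) (k * N) (\<lambda>(i, j). ?K $$ (p i, p j))"
  have P: "?P $$ (i, j) = Q $$ (i mod N, j mod N) * (if i div N = j div N then 1 else 0)"
    if "i < k * N" "j < k * N" for i j
  proof -
    note lt' = lt[OF that(1)] lt[OF that(2)] and dm' = dm[OF that(1)] dm[OF that(2)]
    have "?K $$ (p i, p j)
        = Q $$ (p i div k, p j div k) * (1\<^sub>m k :: 'a mat) $$ (p i mod k, p j mod k)"
      using index_kronecker[of "p i" Q "1\<^sub>m k" "p j"] Q lt'(3,6) by (simp add: mult.commute)
    then show ?thesis unfolding dm' using that lt' by simp
  qed
  have "det ?K = det ?P" by (rule det_permute_rows_cols[OF K p, symmetric])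
  also have "\<dots> = (\<Prod>u<k. det (mat N N (\<lambda>(a, b). ?P $$ (u * N + a, u * N + b))))"
    by (rule det_block_upper_triangular) (use P in auto)
  also have "\<dots> = (\<Prod>u<k. det Q)"
  proof (intro prod.cong refl arg_cong[of _ _ det] eq_matI)
    fix u a b assume "u \<in> {..<k}" "a < dim_row Q" "b < dim_col Q"
    then have *: "u < k" "a < N" "b < N" using Q by auto
    show "mat N N (\<lambda>(a, b). ?P $$ (u * N + a, u * N + b)) $$ (a, b) = Q $$ (a, b)"
      using * P[OF block_index_less[OF *(1,2)] block_index_less[OF *(1,3)]] by simp
  qed (use Q in auto)
  finally show ?thesis by simp
qed

lemma sum_block_index:
  fixes f :: "nat \<Rightarrow> 'a::comm_monoid_add"
  shows "(\<Sum>i<N * k. f i) = (\<Sum>u<N. \<Sum>a<k. f (u * k + a))"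
proof -
  have "(\<Sum>i<N * k. f i) = (\<Sum>u<N. sum f {u * k..<u * k + k})"
    by (rule sum.nat_group[symmetric])
  also have "\<dots> = (\<Sum>u<N. \<Sum>a<k. f (u * k + a))"
    using sum.shift_bounds_nat_ivl[of f 0 "_ * k" k]
    by (simp add: lessThan_atLeast0 add.commute)
  finally show ?thesis .
qed

lemma kronecker_mult:
  fixes A B C D :: "'a::comm_semiring_0 mat"
  assumes A: "A \<in> carrier_mat n m" and C: "C \<in> carrier_mat m l"
    and B: "B \<in> carrier_mat p q" and D: "D \<in> carrier_mat q r"
  shows "(A \<otimes>\<^sub>K B) * (C \<otimes>\<^sub>K D) = (A * C) \<otimes>\<^sub>K (B * D)"
proof (rule eq_matI)
  note carr = kronecker_carrier_mat[OF A B] kronecker_carrier_mat[OF C D]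
    kronecker_carrier_mat[OF mult_carrier_mat[OF A C] mult_carrier_mat[OF B D]]
  show "dim_row ((A \<otimes>\<^sub>K B) * (C \<otimes>\<^sub>K D)) = dim_row ((A * C) \<otimes>\<^sub>K (B * D))"
    "dim_col ((A \<otimes>\<^sub>K B) * (C \<otimes>\<^sub>K D)) = dim_col ((A * C) \<otimes>\<^sub>K (B * D))"
    using carr by auto
  fix i j assume "i < dim_row ((A * C) \<otimes>\<^sub>K (B * D))" "j < dim_col ((A * C) \<otimes>\<^sub>K (B * D))"
  then have i: "i < n * p" and j: "j < l * r" using carr by auto
  have id: "i div p < n" "i mod p < p" and jd: "j div r < l" "j mod r < r"
    using i j by (auto intro: less_mult_imp_div_less mod_less_factor)
  let ?ip = "i div p" and ?im = "i mod p" and ?jp = "j div r" and ?jm = "j mod r"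
  have "((A \<otimes>\<^sub>K B) * (C \<otimes>\<^sub>K D)) $$ (i, j)
      = (\<Sum>h<m * q. (A \<otimes>\<^sub>K B) $$ (i, h) * (C \<otimes>\<^sub>K D) $$ (h, j))"
    using carr i j by (simp add: scalar_prod_def lessThan_atLeast0)
  also have "\<dots> = (\<Sum>u<m. \<Sum>a<q. (A $$ (?ip, u) * B $$ (?im, a)) * (C $$ (u, ?jp) * D $$ (a, ?jm)))"
    unfolding sum_block_index
  proof (intro sum.cong refl)
    fix u a assume "u \<in> {..<m}" "a \<in> {..<q}"
    then have "u * q + a < m * q" "a < q" by (auto intro: block_index_less)
    then show "(A \<otimes>\<^sub>K B) $$ (i, u * q + a) * (C \<otimes>\<^sub>K D) $$ (u * q + a, j)
        = (A $$ (?ip, u) * B $$ (?im, a)) * (C $$ (u, ?jp) * D $$ (a, ?jm))"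
      using A B C D i j by (simp add: kronecker_def)
  qed
  also have "\<dots> = (\<Sum>u<m. A $$ (?ip, u) * C $$ (u, ?jp)) * (\<Sum>a<q. B $$ (?im, a) * D $$ (a, ?jm))"
    by (simp add: sum_product algebra_simps)
  also have "\<dots> = (A * C) $$ (?ip, ?jp) * (B * D) $$ (?im, ?jm)"
    using A B C D id jd by (simp add: scalar_prod_def lessThan_atLeast0)
  also have "\<dots> = ((A * C) \<otimes>\<^sub>K (B * D)) $$ (i, j)"
    using A B C D i j by (simp add: kronecker_def)
  finally show "((A \<otimes>\<^sub>K B) * (C \<otimes>\<^sub>K D)) $$ (i, j) = ((A * C) \<otimes>\<^sub>K (B * D)) $$ (i, j)" .
qed

section \<open>Entrywise sums of matrices\<close>

lemma mat_sum_carrier_mat [simp]: "mat_sum s F I \<in> carrier_mat s s"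
  by (simp add: mat_sum_def)

lemma mult_mat_sum:
  fixes A :: "'a::semiring_0 mat"
  assumes A: "A \<in> carrier_mat s s" and F: "\<And>\<alpha>. \<alpha> \<in> I \<Longrightarrow> F \<alpha> \<in> carrier_mat s s"
  shows "A * mat_sum s F I = mat_sum s (\<lambda>\<alpha>. A * F \<alpha>) I"
proof (rule eq_matI)
  fix i j assume "i < dim_row (mat_sum s (\<lambda>\<alpha>. A * F \<alpha>) I)" "j < dim_col (mat_sum s (\<lambda>\<alpha>. A * F \<alpha>) I)"
  then have ij: "i < s" "j < s" by (auto simp: mat_sum_def)
  have "(A * mat_sum s F I) $$ (i, j) = (\<Sum>h<s. \<Sum>\<alpha>\<in>I. A $$ (i, h) * F \<alpha> $$ (h, j))"
    using A ij by (simp add: scalar_prod_def mat_sum_def lessThan_atLeast0 sum_distrib_left)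
  also have "\<dots> = (\<Sum>\<alpha>\<in>I. \<Sum>h<s. A $$ (i, h) * F \<alpha> $$ (h, j))" by (rule sum.swap)
  also have "\<dots> = mat_sum s (\<lambda>\<alpha>. A * F \<alpha>) I $$ (i, j)"
    using A ij by (auto simp: mat_sum_def scalar_prod_def lessThan_atLeast0 intro!: sum.cong dest: F)
  finally show "(A * mat_sum s F I) $$ (i, j) = mat_sum s (\<lambda>\<alpha>. A * F \<alpha>) I $$ (i, j)" .
qed (use A in \<open>auto simp: mat_sum_def\<close>)

lemma mat_sum_mult:
  fixes A :: "'a::semiring_0 mat"
  assumes A: "A \<in> carrier_mat s s" and F: "\<And>\<alpha>. \<alpha> \<in> I \<Longrightarrow> F \<alpha> \<in> carrier_mat s s"
  shows "mat_sum s F I * A = mat_sum s (\<lambda>\<alpha>. F \<alpha> * A) I"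
proof (rule eq_matI)
  fix i j assume "i < dim_row (mat_sum s (\<lambda>\<alpha>. F \<alpha> * A) I)" "j < dim_col (mat_sum s (\<lambda>\<alpha>. F \<alpha> * A) I)"
  then have ij: "i < s" "j < s" by (auto simp: mat_sum_def)
  have "(mat_sum s F I * A) $$ (i, j) = (\<Sum>h<s. \<Sum>\<alpha>\<in>I. F \<alpha> $$ (i, h) * A $$ (h, j))"
    using A ij by (simp add: scalar_prod_def mat_sum_def lessThan_atLeast0 sum_distrib_right)
  also have "\<dots> = (\<Sum>\<alpha>\<in>I. \<Sum>h<s. F \<alpha> $$ (i, h) * A $$ (h, j))" by (rule sum.swap)
  also have "\<dots> = mat_sum s (\<lambda>\<alpha>. F \<alpha> * A) I $$ (i, j)"
    using A ij by (auto simp: mat_sum_def scalar_prod_def lessThan_atLeast0 intro!: sum.cong dest: F)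
  finally show "(mat_sum s F I * A) $$ (i, j) = mat_sum s (\<lambda>\<alpha>. F \<alpha> * A) I $$ (i, j)" .
qed (use A in \<open>auto simp: mat_sum_def\<close>)

lemma mat_sum_cong:
  "(\<And>\<alpha>. \<alpha> \<in> I \<Longrightarrow> F \<alpha> = G \<alpha>) \<Longrightarrow> mat_sum s F I = mat_sum s G I"
  by (simp add: mat_sum_def)

lemma mult_affine_mat_sum_mult:
  fixes Q Z :: "'a::semiring_0 mat"
  assumes Q: "Q \<in> carrier_mat s s" and Z: "Z \<in> carrier_mat s s" and F0: "F0 \<in> carrier_mat s s"
    and F: "\<And>\<alpha>. \<alpha> \<in> I \<Longrightarrow> F \<alpha> \<in> carrier_mat s s"
  shows "Q * (F0 + mat_sum s F I) * Z = Q * F0 * Z + mat_sum s (\<lambda>\<alpha>. Q * F \<alpha> * Z) I"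
proof -
  have "Q * (F0 + mat_sum s F I) * Z = (Q * F0 + mat_sum s (\<lambda>\<alpha>. Q * F \<alpha>) I) * Z"
    using mult_add_distrib_mat[OF Q F0, of "mat_sum s F I"] mult_mat_sum[of Q s I F] Q F by simp
  also have "\<dots> = Q * F0 * Z + mat_sum s (\<lambda>\<alpha>. Q * F \<alpha>) I * Z"
    by (rule add_mult_distrib_mat[OF mult_carrier_mat[OF Q F0] mat_sum_carrier_mat Z])
  also have "mat_sum s (\<lambda>\<alpha>. Q * F \<alpha>) I * Z = mat_sum s (\<lambda>\<alpha>. Q * F \<alpha> * Z) I"
    by (rule mat_sum_mult[OF Z mult_carrier_mat[OF Q F]])
  finally show ?thesis .
qed

section \<open>Linear independence of the variables \<open>c\<^sub>\<alpha>\<close> over \<open>K[x]\<close>\<close>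

lemma lookup_single_times:
  fixes p :: "('b::cancel_comm_monoid_add) \<Rightarrow>\<^sub>0 ('a::comm_semiring_1)"
  shows "Poly_Mapping.lookup (Poly_Mapping.single u 1 * p) (u + m) = Poly_Mapping.lookup p m"
proof -
  have "Poly_Mapping.lookup (Poly_Mapping.single u 1 * p) (u + m)
    = Sum_any (\<lambda>l. Poly_Mapping.lookup p m when u = l)"
    unfolding lookup_mult lookup_single
    by (intro Sum_any.cong) (auto simp: when_def)
  then show ?thesis by simp
qed

lemma lookup_single_times_eq_0:
  fixes p :: "('b::cancel_comm_monoid_add) \<Rightarrow>\<^sub>0 ('a::comm_semiring_1)"
  assumes "\<And>m'. m \<noteq> u + m'"
  shows "Poly_Mapping.lookup (Poly_Mapping.single u 1 * p) m = 0"
proof -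
  have "(1 when u = l) * Sum_any (\<lambda>q. Poly_Mapping.lookup p q when m = l + q) = 0" for l
    using assms by (cases "u = l") auto
  then show ?thesis unfolding lookup_mult lookup_single by simp
qed

lemma polys_in_x_lookup_eq_0:
  assumes "p \<in> polys_in_x n" "Poly_Mapping.lookup m (Cvar \<alpha>) \<noteq> 0"
  shows "Poly_Mapping.lookup p m = 0"
proof (rule ccontr)
  assume "Poly_Mapping.lookup p m \<noteq> 0"
  then have "m \<in> Poly_Mapping.keys p" by (simp add: in_keys_iff)
  moreover have "Cvar \<alpha> \<in> Poly_Mapping.keys m" using assms(2) by (simp add: in_keys_iff)
  ultimately show False using assms(1) by (auto simp: polys_in_x_def)
qed

lemma polys_in_x_add: "p \<in> polys_in_x n \<Longrightarrow> q \<in> polys_in_x n \<Longrightarrow> p + q \<in> polys_in_x n"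
  using keys_add[of p q] by (auto simp: polys_in_x_def)

lemma polys_in_x_diff: "p \<in> polys_in_x n \<Longrightarrow> q \<in> polys_in_x n \<Longrightarrow> p - q \<in> polys_in_x n"
  using keys_diff[of p q] unfolding polys_in_x_def by blast

lemma polys_in_x_0: "0 \<in> polys_in_x n" by (simp add: polys_in_x_def)
lemma polys_in_x_1: "1 \<in> polys_in_x n" by (simp add: polys_in_x_def)

lemma polys_in_x_mult:
  assumes "p \<in> polys_in_x n" "q \<in> polys_in_x n"
  shows "p * q \<in> polys_in_x n"
proof -
  have "Poly_Mapping.keys m \<subseteq> Xvar ` {1..n}" if m: "m \<in> Poly_Mapping.keys (p * q)" for m
  proof -
    obtain a b where ab: "m = a + b" "a \<in> Poly_Mapping.keys p" "b \<in> Poly_Mapping.keys q"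
      using keys_mult[of p q] m by blast
    have "Poly_Mapping.keys m \<subseteq> Poly_Mapping.keys a \<union> Poly_Mapping.keys b"
      unfolding ab(1) by (rule keys_add)
    then show ?thesis using assms ab(2,3) unfolding polys_in_x_def by blast
  qed
  then show ?thesis by (auto simp: polys_in_x_def)
qed

lemma polys_in_x_sum: "(\<And>i. i \<in> I \<Longrightarrow> f i \<in> polys_in_x n) \<Longrightarrow> sum f I \<in> polys_in_x n"
  by (induction I rule: infinite_finite_induct) (auto intro: polys_in_x_add polys_in_x_0)

lemma polys_in_x_prod: "(\<And>i. i \<in> I \<Longrightarrow> f i \<in> polys_in_x n) \<Longrightarrow> prod f I \<in> polys_in_x n"
  by (induction I rule: infinite_finite_induct) (auto intro: polys_in_x_mult polys_in_x_1)

lemma polys_in_x_power: "p \<in> polys_in_x n \<Longrightarrow> p ^ e \<in> polys_in_x n"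
  by (induction e) (auto intro: polys_in_x_mult polys_in_x_1)

lemma polys_in_x_xpow: "xpow n \<alpha> \<in> polys_in_x n"
  unfolding xpow_def
  by (intro polys_in_x_prod polys_in_x_power) (auto simp: x_var_def polys_in_x_def)

lemma polys_in_x_mat_mult:
  assumes "A \<in> carrier_mat s s" "B \<in> carrier_mat s s"
    and "entries_in A (polys_in_x n)" "entries_in B (polys_in_x n)"
  shows "entries_in (A * B) (polys_in_x n)"
  using assms unfolding entries_in_def
  by (auto simp: scalar_prod_def intro!: polys_in_x_sum polys_in_x_mult)

text \<open>
  The monomials of \<open>p0\<close> contain no variable \<open>c\<close>, and those of \<open>c\<^sub>\<alpha> p\<^sub>\<alpha>\<close> contain \<open>c\<^sub>\<alpha>\<close>
  and no other variable \<open>c\<close>. Hence no two summands have a common monomial, and every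
  coefficient of \<open>p0\<close> and of the \<open>p\<^sub>\<alpha>\<close> is a coefficient of the whole sum.
\<close>

lemma c_var_independent:
  assumes fin: "finite I" and p0: "p0 \<in> polys_in_x n"
    and p: "\<And>\<alpha>. \<alpha> \<in> I \<Longrightarrow> p \<alpha> \<in> polys_in_x n"
    and eq: "p0 + (\<Sum>\<alpha>\<in>I. c_var \<alpha> * p \<alpha>) = 0"
  shows "p0 = 0" and "\<And>\<beta>. \<beta> \<in> I \<Longrightarrow> p \<beta> = 0"
proof -
  let ?u = "\<lambda>\<alpha>. Poly_Mapping.single (Cvar \<alpha>) (1::nat)"
  have eq_at: "Poly_Mapping.lookup p0 m + (\<Sum>\<alpha>\<in>I. Poly_Mapping.lookup (c_var \<alpha> * p \<alpha>) m) = 0" for m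
    using arg_cong[OF eq, of "\<lambda>q. Poly_Mapping.lookup q m"] by (simp add: lookup_add lookup_sum)
  have zero: "Poly_Mapping.lookup (c_var \<alpha> * p \<alpha>) m = 0" if "Poly_Mapping.lookup m (Cvar \<alpha>) = 0" for \<alpha> m
    unfolding c_var_def
  proof (rule lookup_single_times_eq_0)
    fix m' show "m \<noteq> ?u \<alpha> + m'"
      using that by (auto simp: lookup_add)
  qed
  show "p0 = 0"
  proof (rule poly_mapping_eqI)
    fix m
    show "Poly_Mapping.lookup p0 m = Poly_Mapping.lookup 0 m"
    proof (cases "\<exists>\<alpha>. Poly_Mapping.lookup m (Cvar \<alpha>) \<noteq> 0")
      case True
      then show ?thesis using polys_in_x_lookup_eq_0[OF p0] by auto
    next
      case False
      then show ?thesis using eq_at[of m] zero[of m] by simp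
    qed
  qed
  fix \<beta> assume \<beta>: "\<beta> \<in> I"
  show "p \<beta> = 0"
  proof (rule poly_mapping_eqI)
    fix m
    show "Poly_Mapping.lookup (p \<beta>) m = Poly_Mapping.lookup 0 m"
    proof (cases "\<exists>\<alpha>. Poly_Mapping.lookup m (Cvar \<alpha>) \<noteq> 0")
      case True
      then show ?thesis using polys_in_x_lookup_eq_0[OF p[OF \<beta>]] by auto
    next
      case False
      \<comment> \<open>Only the summand for \<open>\<beta>\<close> contributes to the coefficient of the monomial \<open>c\<^sub>\<beta> m\<close>.\<close>
      have "Poly_Mapping.lookup (c_var \<alpha> * p \<alpha>) (?u \<beta> + m)
          = (if \<alpha> = \<beta> then Poly_Mapping.lookup (p \<beta>) m else 0)" for \<alpha>
        using False zero[of "?u \<beta> + m" \<alpha>]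
        by (auto simp: lookup_add lookup_single_not_eq c_var_def lookup_single_times)
      then show ?thesis using eq_at[of "?u \<beta> + m"] \<open>p0 = 0\<close> \<beta> fin by simp
    qed
  qed
qed

section \<open>The representation of the matrix polynomial\<close>

theorem theorem7p1:
  fixes n d N k :: nat
    and M M0 :: "'a::field pring mat"
    and M\<alpha> :: "multi_index \<Rightarrow> 'a pring mat"
    and C :: "multi_index \<Rightarrow> 'a mat"
  assumes rep: "uniform_det_rep n d N M"
    and M0: "M0 \<in> carrier_mat N N" "entries_in M0 {p \<in> polys_in_x n. tdeg p \<le> 1}"
    and M\<alpha>: "\<And>\<alpha>. \<alpha> \<in> multi_indices n d \<Longrightarrow>
               M\<alpha> \<alpha> \<in> carrier_mat N N \<and> entries_in (M\<alpha> \<alpha>) {p \<in> polys_in_x n. tdeg p \<le> 1}"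
    and M_eq: "M = M0 + mat_sum N (\<lambda>\<alpha>. c_var \<alpha> \<cdot>\<^sub>m M\<alpha> \<alpha>) (multi_indices n d)"
    and QZ: "\<exists>Q Z. Q \<in> carrier_mat N N \<and> Z \<in> carrier_mat N N
               \<and> entries_in Q (polys_in_x n) \<and> entries_in Z (polys_in_x n)
               \<and> det Q = 1 \<and> det Z = 1
               \<and> triangular (Q * M * Z)
               \<and> (\<exists>r<N. (Q * M * Z) $$ (r, r) = generic_poly n d
                        \<and> (\<forall>i<N. i \<noteq> r \<longrightarrow> (Q * M * Z) $$ (i, i) = 1))"
    and C: "\<And>\<alpha>. \<alpha> \<in> multi_indices n d \<Longrightarrow> C \<alpha> \<in> carrier_mat k k"
  shows "det (M0 \<otimes>\<^sub>K 1\<^sub>m k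
              + mat_sum (N * k) (\<lambda>\<alpha>. M\<alpha> \<alpha> \<otimes>\<^sub>K map_mat const (C \<alpha>)) (multi_indices n d))
         = det (matrix_poly n d k C)"
proof -
  obtain Q Z r where Q: "Q \<in> carrier_mat N N" and Z: "Z \<in> carrier_mat N N"
    and Qx: "entries_in Q (polys_in_x n)" and Zx: "entries_in Z (polys_in_x n)"
    and detQ: "det Q = 1" and detZ: "det Z = 1" and tri: "triangular (Q * M * Z)"
    and r: "r < N" and Tr: "(Q * M * Z) $$ (r, r) = generic_poly n d"
    and Ti: "\<And>i. i < N \<Longrightarrow> i \<noteq> r \<Longrightarrow> (Q * M * Z) $$ (i, i) = 1"
    using QZ by auto
  define I where "I = multi_indices n d"
  define T0 where "T0 = Q * M0 * Z"
  define T where "T \<alpha> = Q * M\<alpha> \<alpha> * Z" for \<alpha>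
  define D where "D \<alpha> = map_mat const (C \<alpha>)" for \<alpha>
  define S where "S = M0 \<otimes>\<^sub>K 1\<^sub>m k + mat_sum (N * k) (\<lambda>\<alpha>. M\<alpha> \<alpha> \<otimes>\<^sub>K D \<alpha>) I"
  define S' where "S' = T0 \<otimes>\<^sub>K 1\<^sub>m k + mat_sum (N * k) (\<lambda>\<alpha>. T \<alpha> \<otimes>\<^sub>K D \<alpha>) I"
  have fin: "finite I" by (simp add: I_def finite_multi_indices)
  have Mc: "M\<alpha> \<alpha> \<in> carrier_mat N N" and Mx: "entries_in (M\<alpha> \<alpha>) (polys_in_x n)"
    and Dc: "D \<alpha> \<in> carrier_mat k k" if "\<alpha> \<in> I" for \<alpha>
    using that M\<alpha> C by (auto simp: I_def D_def entries_in_def)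
  have M0x: "entries_in M0 (polys_in_x n)"
    using M0 by (auto simp: entries_in_def)
  have T0c: "T0 \<in> carrier_mat N N" using Q M0(1) Z by (simp add: T0_def)
  have Tc: "T \<alpha> \<in> carrier_mat N N" if "\<alpha> \<in> I" for \<alpha> using Q Mc[OF that] Z by (simp add: T_def)
  have T0x: "entries_in T0 (polys_in_x n)"
    unfolding T0_def using Q M0(1) Z Qx M0x Zx
    by (intro polys_in_x_mat_mult[of _ N] mult_carrier_mat)
  have Tx: "entries_in (T \<alpha>) (polys_in_x n)" if "\<alpha> \<in> I" for \<alpha>
    unfolding T_def using Q Mc[OF that] Z Qx Mx[OF that] Zx
    by (intro polys_in_x_mat_mult[of _ N] mult_carrier_mat)

  have "Q * M * Z = T0 + mat_sum N (\<lambda>\<alpha>. Q * (c_var \<alpha> \<cdot>\<^sub>m M\<alpha> \<alpha>) * Z) I"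
    unfolding M_eq I_def[symmetric] T0_def
    by (rule mult_affine_mat_sum_mult) (use Q Z M0(1) Mc in auto)
  also have "mat_sum N (\<lambda>\<alpha>. Q * (c_var \<alpha> \<cdot>\<^sub>m M\<alpha> \<alpha>) * Z) I = mat_sum N (\<lambda>\<alpha>. c_var \<alpha> \<cdot>\<^sub>m T \<alpha>) I"
  proof (rule mat_sum_cong)
    fix \<alpha> assume "\<alpha> \<in> I"
    note mc = Mc[OF this]
    show "Q * (c_var \<alpha> \<cdot>\<^sub>m M\<alpha> \<alpha>) * Z = c_var \<alpha> \<cdot>\<^sub>m T \<alpha>"
      using mult_smult_distrib[OF Q mc] mult_smult_assoc_mat[OF mult_carrier_mat[OF Q mc] Z]
      by (simp add: T_def)
  qed
  finally have QMZ_sum: "Q * M * Z = T0 + mat_sum N (\<lambda>\<alpha>. c_var \<alpha> \<cdot>\<^sub>m T \<alpha>) I" .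
  have QMZ: "(Q * M * Z) $$ (i, j) = T0 $$ (i, j) + (\<Sum>\<alpha>\<in>I. c_var \<alpha> * T \<alpha> $$ (i, j))"
    if "i < N" "j < N" for i j
  proof -
    have "(c_var \<alpha> \<cdot>\<^sub>m T \<alpha>) $$ (i, j) = c_var \<alpha> * T \<alpha> $$ (i, j)" if "\<alpha> \<in> I" for \<alpha>
      using Tc[OF that] \<open>i < N\<close> \<open>j < N\<close> by simp
    then show ?thesis using that T0c by (simp add: QMZ_sum mat_sum_def)
  qed
  \<comment> \<open>An entry of \<open>Q * M * Z\<close> that is written as a \<open>K[x]\<close>-combination of \<open>1\<close> and the \<open>c\<^sub>\<alpha>\<close>
    determines the corresponding entries of all coefficient matrices.\<close>
  have coeffs: "T0 $$ (i, j) = q0 \<and> (\<forall>\<alpha>\<in>I. T \<alpha> $$ (i, j) = q \<alpha>)"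
    if ij: "i < N" "j < N" and q0: "q0 \<in> polys_in_x n" and q: "\<And>\<alpha>. q \<alpha> \<in> polys_in_x n"
      and eq: "(Q * M * Z) $$ (i, j) = q0 + (\<Sum>\<alpha>\<in>I. c_var \<alpha> * q \<alpha>)" for i j q0 q
  proof -
    have 0: "(T0 $$ (i, j) - q0) + (\<Sum>\<alpha>\<in>I. c_var \<alpha> * (T \<alpha> $$ (i, j) - q \<alpha>)) = 0"
      using QMZ[OF ij] eq by (simp add: right_diff_distrib sum_subtractf algebra_simps)
    have 1: "T0 $$ (i, j) - q0 \<in> polys_in_x n"
      using ij T0c T0x q0 by (auto simp: entries_in_def intro: polys_in_x_diff)
    have 2: "T \<alpha> $$ (i, j) - q \<alpha> \<in> polys_in_x n" if "\<alpha> \<in> I" for \<alpha>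
      using ij Tc[OF that] Tx[OF that] q by (auto simp: entries_in_def intro: polys_in_x_diff)
    show ?thesis
      using c_var_independent[OF fin 1 2 0] by auto
  qed

  have S'_index: "S' $$ (i, j) = T0 $$ (i div k, j div k) * 1\<^sub>m k $$ (i mod k, j mod k)
      + (\<Sum>\<alpha>\<in>I. T \<alpha> $$ (i div k, j div k) * D \<alpha> $$ (i mod k, j mod k))"
    if "i < N * k" "j < N * k" for i j
  proof -
    have "(T \<alpha> \<otimes>\<^sub>K D \<alpha>) $$ (i, j) = T \<alpha> $$ (i div k, j div k) * D \<alpha> $$ (i mod k, j mod k)"
      if "\<alpha> \<in> I" for \<alpha>
      using index_kronecker[of i "T \<alpha>" "D \<alpha>" j] Tc[OF that] Dc[OF that] \<open>i < N * k\<close> \<open>j < N * k\<close>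
      by simp
    moreover have "(T0 \<otimes>\<^sub>K 1\<^sub>m k) $$ (i, j) = T0 $$ (i div k, j div k) * 1\<^sub>m k $$ (i mod k, j mod k)"
      using index_kronecker[of i T0 "1\<^sub>m k" j] T0c that by simp
    ultimately show ?thesis
      using that by (simp add: S'_def mat_sum_def)
  qed
  have S'c: "S' \<in> carrier_mat (N * k) (N * k)"
    by (simp add: S'_def)
  have div_less: "i div k < N" if "i < N * k" for i
    using that by (simp add: less_mult_imp_div_less)
  have zero: "S' $$ (i, j) = 0"
    if "i < N * k" "j < N * k" and eq: "(Q * M * Z) $$ (i div k, j div k) = 0" for i j
    using coeffs[of "i div k" "j div k" 0 "\<lambda>_. 0"] S'_index[OF that(1,2)] eq that(1,2)
    by (simp add: div_less polys_in_x_0)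

  let ?block = "\<lambda>u. mat k k (\<lambda>(a, b). S' $$ (u * k + a, u * k + b))"
  have block_index: "S' $$ (u * k + a, u * k + b) =
      T0 $$ (u, u) * 1\<^sub>m k $$ (a, b) + (\<Sum>\<alpha>\<in>I. T \<alpha> $$ (u, u) * D \<alpha> $$ (a, b))"
    if "u < N" "a < k" "b < k" for u a b
    using S'_index[of "u * k + a" "u * k + b"] that by (simp add: block_index_less)
  have block_r: "?block r = matrix_poly n d k C"
  proof (rule eq_matI)
    have co: "T0 $$ (r, r) = 0 \<and> (\<forall>\<alpha>\<in>I. T \<alpha> $$ (r, r) = xpow n \<alpha>)"
      by (rule coeffs[OF r r]) (auto simp: polys_in_x_0 polys_in_x_xpow Tr generic_poly_def I_def)
    fix a b assume "a < dim_row (matrix_poly n d k C)" "b < dim_col (matrix_poly n d k C)"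
    then have ab: "a < k" "b < k" by (auto simp: matrix_poly_def mat_sum_def)
    have "(xpow n \<alpha> \<cdot>\<^sub>m map_mat const (C \<alpha>)) $$ (a, b) = xpow n \<alpha> * D \<alpha> $$ (a, b)" if "\<alpha> \<in> I" for \<alpha>
      using Dc[OF that] ab by (simp add: D_def)
    then show "?block r $$ (a, b) = matrix_poly n d k C $$ (a, b)"
      using co block_index[OF r ab] ab
      by (simp add: matrix_poly_def mat_sum_def I_def[symmetric])
  qed (auto simp: matrix_poly_def mat_sum_def)
  have block_one: "?block u = 1\<^sub>m k" if u: "u < N" "u \<noteq> r" for u
  proof (rule eq_matI)
    have co: "T0 $$ (u, u) = 1 \<and> (\<forall>\<alpha>\<in>I. T \<alpha> $$ (u, u) = 0)"
      by (rule coeffs) (use u in \<open>auto simp: polys_in_x_0 polys_in_x_1 Ti\<close>)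
    fix a b assume "a < dim_row (1\<^sub>m k :: 'a pring mat)" "b < dim_col (1\<^sub>m k :: 'a pring mat)"
    then have ab: "a < k" "b < k" by auto
    show "?block u $$ (a, b) = 1\<^sub>m k $$ (a, b)"
      using co block_index[OF u(1) ab] ab by simp
  qed auto

  have dims: "dim_row (Q * M * Z) = N" "dim_col (Q * M * Z) = N" using Q Z by auto
  have "det S' = (\<Prod>u<N. det (?block u))"
  proof (cases "upper_triangular (Q * M * Z)")
    case True
    show ?thesis
    proof (rule det_block_upper_triangular[OF S'c])
      fix i j assume ij: "i < N * k" "j < N * k" "j div k < i div k"
      then have "(Q * M * Z) $$ (i div k, j div k) = 0"
        using upper_triangularD[OF True] dims div_less by simp
      then show "S' $$ (i, j) = 0" by (rule zero[OF ij(1,2)])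
    qed
  next
    case False
    then have low: "upper_triangular (transpose_mat (Q * M * Z))" using tri by (simp add: triangular_def)
    show ?thesis
    proof (rule det_block_lower_triangular[OF S'c])
      fix i j assume ij: "i < N * k" "j < N * k" "i div k < j div k"
      then have "transpose_mat (Q * M * Z) $$ (j div k, i div k) = 0"
        using upper_triangularD[OF low] dims div_less by simp
      then have "(Q * M * Z) $$ (i div k, j div k) = 0"
        using ij dims div_less by simp
      then show "S' $$ (i, j) = 0" by (rule zero[OF ij(1,2)])
    qed
  qed
  also have "\<dots> = (\<Prod>u<N. if u = r then det (matrix_poly n d k C) else 1)"
    using block_r block_one by (intro prod.cong) auto
  also have "\<dots> = det (matrix_poly n d k C)" using r by simp
  finally have det_S': "det S' = det (matrix_poly n d k C)" .

  let ?Q = "Q \<otimes>\<^sub>K 1\<^sub>m k" and ?Z = "Z \<otimes>\<^sub>K 1\<^sub>m k"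
  have Kc: "?Q \<in> carrier_mat (N * k) (N * k)" "?Z \<in> carrier_mat (N * k) (N * k)"
    using Q Z by auto
  have Sc: "S \<in> carrier_mat (N * k) (N * k)" by (simp add: S_def)
  have mixed: "?Q * (A \<otimes>\<^sub>K B) * ?Z = (Q * A * Z) \<otimes>\<^sub>K B"
    if A: "A \<in> carrier_mat N N" and B: "B \<in> carrier_mat k k" for A B
    using kronecker_mult[OF Q A one_carrier_mat B]
      kronecker_mult[OF mult_carrier_mat[OF Q A] Z B one_carrier_mat] B by simp
  have "?Q * S * ?Z = ?Q * (M0 \<otimes>\<^sub>K 1\<^sub>m k) * ?Z
      + mat_sum (N * k) (\<lambda>\<alpha>. ?Q * (M\<alpha> \<alpha> \<otimes>\<^sub>K D \<alpha>) * ?Z) I"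
    unfolding S_def by (rule mult_affine_mat_sum_mult) (use Kc M0(1) Mc Dc in auto)
  also have "\<dots> = S'"
    unfolding S'_def using mixed M0(1) Mc Dc
    by (auto simp: T0_def T_def intro!: arg_cong2[of _ _ _ _ "(+)"] mat_sum_cong)
  finally have "det S' = det ?Q * det S * det ?Z"
    using det_mult[OF Kc(1) Sc] det_mult[OF mult_carrier_mat[OF Kc(1) Sc] Kc(2)] by simp
  also have "\<dots> = det S"
    using det_kronecker_one[OF Q] det_kronecker_one[OF Z] detQ detZ by simp
  finally show ?thesis
    using det_S' by (simp add: S_def D_def I_def)
qed

end
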